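(* In the setting of the context, let the graph with vertex set $[d]=\{1,\dots,d\}$ and edge set $\mathcal E_s$ have exactly $K$ connected components with vertex sets $\mathcal C_1,\dots,\mathcal C_K$ (pairwise disjoint, with union $[d]$). Let $\mathbf C_I=[\mathbb 1_{\mathcal C_1},\dots,\mathbb 1_{\mathcal C_K}]\in\mathbb R^{d\times K}$, whose $k$-th column is the indicator vector of $\mathcal C_k$. Then the following are equivalent: (i) for any $\mathbf w,\mathbf w'\in\{\mathbf w\in\mathbb R^p:\mathbf A\mathbf w=\mathbf b\}$, if $p_\alpha(\mathbf w)=p_\alpha(\mathbf w')$ for all $\alpha\in\mathcal E_s$, then $\mathbf w=\mathbf w'$; (ii) $\mathrm{rank}\big([\mathbf C_I,\ \mathfrak A\mathbf V]\big)=d_\theta+K$.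
   Context: Fix an integer $d$, feature vectors $\phi(\mathbf x_1),\dots,\phi(\mathbf x_d)\in\mathbb R^p$, the matrix $\mathfrak A\in\mathbb R^{d\times p}$ with rows $\phi(\mathbf x_i)^\top$, a scale $0<\sigma<\infty$, and a consistent linear system $\mathbf A\mathbf w=\mathbf b$ with $\mathbf A\in\mathbb R^{l\times p}$, $\mathbf b\in\mathbb R^l$. Let $r_A=\mathrm{rank}(\mathbf A)$, $d_\theta=p-r_A$, and let $\mathbf V\in\mathbb R^{p\times d_\theta}$ have orthonormal columns spanning $\mathrm{Null}(\mathbf A)$. Let $\mathcal E_s\subseteq\{(i,j):1\le i<j\le d\}$ be the set of queried pairs. For $\alpha=(i,j)\in\mathcal E_s$ let $\mathbf a_\alpha=\mathfrak A^\top(\mathbf e_i-\mathbf e_j)$ and define the choice probability $p_\alpha(\mathbf w)=\dfrac1{1+\exp(-\mathbf w^\top\mathbf a_\alpha/\sigma)}$. Isolated vertices form their own connected components. *)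

theory Defs
  imports Complex_Main "Jordan_Normal_Form.DL_Rank" "Jordan_Normal_Form.Matrix_Kernel"
begin

text \<open>
  Vectors and matrices are those of Jordan-Normal-Form, with explicit natural-number dimensions;
  all dimensions, and in particular the derived ones \<open>d\<^sub>\<theta> = p - rank A\<close> and \<open>K\<close>, may be zero.
  Indices are 0-based, so \<open>[d] = {1,\<dots>,d}\<close> becomes \<open>{..<d}\<close>.
\<close>

definition feature_matrix :: "nat \<Rightarrow> nat \<Rightarrow> ('x \<Rightarrow> real vec) \<Rightarrow> (nat \<Rightarrow> 'x) \<Rightarrow> real mat" where
  "feature_matrix d p \<phi> x = mat_of_rows p (map (\<lambda>i. \<phi> (x i)) [0..<d])"

definition query_vector :: "real mat \<Rightarrow> nat \<times> nat \<Rightarrow> real vec" where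
  "query_vector F = (\<lambda>(i, j).
     transpose_mat F *\<^sub>v (unit_vec (dim_row F) i - unit_vec (dim_row F) j))"

definition choice_prob :: "real mat \<Rightarrow> real \<Rightarrow> nat \<times> nat \<Rightarrow> real vec \<Rightarrow> real" where
  "choice_prob F \<sigma> \<alpha> w = 1 / (1 + exp (- (w \<bullet> query_vector F \<alpha>) / \<sigma>))"

text \<open>
  Each undirected edge is stored as the single pair \<open>(i, j)\<close> with \<open>i < j\<close>; walks may use it in
  either direction. Reflexivity on \<open>{..<d}\<close> makes every isolated vertex a component of its own.
\<close>

definition reachable :: "nat \<Rightarrow> (nat \<times> nat) set \<Rightarrow> (nat \<times> nat) set" where
  "reachable d E = {(i, j). i < d \<and> j < d \<and> (i, j) \<in> (E \<union> E\<inverse>)\<^sup>*}"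

definition graph_components :: "nat \<Rightarrow> (nat \<times> nat) set \<Rightarrow> nat set set" where
  "graph_components d E = {..<d} // reachable d E"

definition component_matrix :: "nat \<Rightarrow> nat \<Rightarrow> (nat \<Rightarrow> nat set) \<Rightarrow> real mat" where
  "component_matrix d K C = mat d K (\<lambda>(i, k). if i \<in> C k then 1 else 0)"

definition append_columns :: "'a mat \<Rightarrow> 'a mat \<Rightarrow> 'a mat" where
  "append_columns M N = mat_of_cols (dim_row M) (cols M @ cols N)"

definition orthonormal_columns :: "real mat \<Rightarrow> bool" where
  "orthonormal_columns V \<longleftrightarrow>
     (\<forall>i<dim_col V. \<forall>j<dim_col V. col V i \<bullet> col V j = (if i = j then 1 else 0))"

end

theory Submission
  imports Defs
begin

text \<open>
  The logistic function is injective and \<open>w \<bullet> a\<^sub>\<alpha> = (F w)\<^sub>i - (F w)\<^sub>j\<close> for \<open>\<alpha> = (i, j)\<close>, so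
  two feasible points have the same choice probabilities iff \<open>F u\<close>, for their difference
  \<open>u \<in> Null A\<close>, is constant on every connected component, i.e. lies in the column space of the
  component matrix. Writing \<open>u = V t\<close>, identifiability says that \<open>C\<^sub>I c + F V t = 0\<close> forces \<open>t = 0\<close>,
  and then \<open>c = 0\<close> because the components are nonempty and disjoint. Hence it is the triviality of
  the kernel of \<open>[C\<^sub>I, F V]\<close>, that is, full column rank.
\<close>

section \<open>Full column rank as triviality of the kernel\<close>

lemma (in vec_space) rank_less_if_not_distinct:
  assumes A: "A \<in> carrier_mat n nc" and nd: "\<not> distinct (cols A)"
  shows "rank A < nc"
proof -
  \<comment> \<open>The rank is the size of a maximal independent subset of the set of columns,
    obtained by enlarging the empty set. A repeated column leaves that set with fewer than
    \<open>nc\<close> elements.\<close>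
  obtain S where S: "maximal S (\<lambda>T. T \<subseteq> set (cols A) \<and> lin_indpt T)"
    using maximal_exists_superset[of "set (cols A)" "\<lambda>T. T \<subseteq> set (cols A) \<and> lin_indpt T" "{}"]
      finite_lin_indpt2[of "{}"] by auto
  have "rank A = card S" by (rule rank_card_indpt[OF A S])
  also have "\<dots> \<le> card (set (cols A))" using S by (intro card_mono) (auto simp: maximal_def)
  also have "\<dots> < nc"
    using nd A card_length[of "cols A"] card_distinct[of "cols A"] by fastforce
  finally show ?thesis .
qed

text \<open>Independence speaks of the set of columns and cannot see repetitions, hence the case
  split. For distinct columns, a nonzero kernel vector is a dependence relation. If columns i and j
  coincide, both sides fail: the rank is too small, and the difference of the two unit vectors is a
  nonzero kernel vector.\<close>

lemma (in vec_space) rank_eq_dim_col_iff: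
  assumes A: "A \<in> carrier_mat n nc"
  shows "rank A = nc \<longleftrightarrow> (\<forall>v \<in> carrier_vec nc. A *\<^sub>v v = 0\<^sub>v n \<longrightarrow> v = 0\<^sub>v nc)"
proof (cases "distinct (cols A)")
  case True
  show ?thesis
    using full_rank_lin_indpt[OF A _ True] lin_indpt_full_rank[OF A True]
      lin_depI[OF A _ _ _ True] lin_depE[OF A _ True] by metis
next
  case False
  then obtain i j where ij: "i < nc" "j < nc" "i \<noteq> j" "col A i = col A j"
    using A unfolding distinct_conv_nth by auto
  let ?v = "unit_vec nc i - unit_vec nc j :: 'a vec"
  have unit: "A *\<^sub>v unit_vec nc k = col A k" if "k < nc" for k
    using A that by (intro eq_vecI) auto
  have "A *\<^sub>v ?v = 0\<^sub>v n"
    using A ij by (subst mult_minus_distrib_mat_vec[OF A]) (auto simp: unit)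
  moreover have "?v $ i \<noteq> 0\<^sub>v nc $ i" using ij by simp
  hence "?v \<noteq> 0\<^sub>v nc" by metis
  moreover have "?v \<in> carrier_vec nc" by simp
  ultimately show ?thesis using rank_less_if_not_distinct[OF A False] by blast
qed

section \<open>Block columns and orthonormal columns\<close>

lemma append_columns_carrier:
  assumes "M \<in> carrier_mat n a" "N \<in> carrier_mat n b"
  shows "append_columns M N \<in> carrier_mat n (a + b)"
  using assms unfolding append_columns_def by (auto intro!: carrier_matI)

lemma append_columns_mult_append_vec:
  fixes M N :: "'a :: semiring_0 mat"
  assumes M: "M \<in> carrier_mat n a" and N: "N \<in> carrier_mat n b"
    and u: "u \<in> carrier_vec a" and v: "v \<in> carrier_vec b"
  shows "append_columns M N *\<^sub>v (u @\<^sub>v v) = M *\<^sub>v u + N *\<^sub>v v"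
proof (rule eq_vecI)
  fix i assume "i < dim_vec (M *\<^sub>v u + N *\<^sub>v v)"
  hence i: "i < n" using N by simp
  have "row (append_columns M N) i = row M i @\<^sub>v row N i"
    using i M N unfolding append_columns_def
    by (intro eq_vecI) (auto simp: mat_of_cols_index nth_append)
  thus "(append_columns M N *\<^sub>v (u @\<^sub>v v)) $ i = (M *\<^sub>v u + N *\<^sub>v v) $ i"
    using i M N append_columns_carrier[OF M N]
      scalar_prod_append[OF _ _ u v, of "row M i" "row N i"] by auto
qed (use N append_columns_carrier[OF M N] in auto)

text \<open>Orthonormality makes the transpose of \<open>V\<close> a left inverse, so coordinates
  with respect to the columns of \<open>V\<close> are unique.\<close>

lemma orthonormal_columns_mult_eq_0D:
  assumes V: "V \<in> carrier_mat n m" and orth: "orthonormal_columns V"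
    and t: "t \<in> carrier_vec m" and 0: "V *\<^sub>v t = 0\<^sub>v n"
  shows "t = 0\<^sub>v m"
proof -
  have "transpose_mat V * V = 1\<^sub>m m"
    using V orth unfolding orthonormal_columns_def by (intro eq_matI) auto
  hence "t = transpose_mat V *\<^sub>v (V *\<^sub>v t)"
    using V t by (metis assoc_mult_mat_vec one_mult_mat_vec transpose_carrier_mat)
  also have "\<dots> = 0\<^sub>v m" unfolding 0 using V by (intro eq_vecI) auto
  finally show ?thesis .
qed

section \<open>Choice probabilities as utility differences\<close>

lemma scalar_prod_query_vector:
  assumes F: "F \<in> carrier_mat d p" and w: "w \<in> carrier_vec p" and ij: "i < d" "j < d"
  shows "w \<bullet> query_vector F (i, j) = (F *\<^sub>v w) $ i - (F *\<^sub>v w) $ j"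
proof -
  let ?u = "unit_vec d i - unit_vec d j :: real vec"
  have "w \<bullet> query_vector F (i, j) = (transpose_mat F *\<^sub>v ?u) \<bullet> w"
    using F w unfolding query_vector_def by (simp add: comm_scalar_prod[of w p])
  also have "\<dots> = ?u \<bullet> (F *\<^sub>v w)"
    using transpose_vec_mult_scalar[OF F w, of ?u] by simp
  also have "\<dots> = (F *\<^sub>v w) $ i - (F *\<^sub>v w) $ j"
    using F w ij by (subst minus_scalar_prod_distrib[of _ d]) auto
  finally show ?thesis .
qed

lemma choice_prob_eq_iff:
  assumes "\<sigma> > 0"
  shows "choice_prob F \<sigma> \<alpha> w = choice_prob F \<sigma> \<alpha> w'
    \<longleftrightarrow> w \<bullet> query_vector F \<alpha> = w' \<bullet> query_vector F \<alpha>"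
proof -
  \<comment> \<open>Nonzero denominators permit cross-multiplication; injectivity of
    \<open>exp\<close> and \<sigma> > 0 then give equality of the arguments.\<close>
  have "1 + exp a \<noteq> 0" for a :: real by (smt (verit) exp_gt_zero)
  thus ?thesis using assms unfolding choice_prob_def by (simp add: frac_eq_eq)
qed

text \<open>By linearity only \<open>w - w'\<close> matters, which turns a comparison of two points
  into a condition on a single vector.\<close>

lemma choice_prob_eq_iff_diff:
  assumes F: "F \<in> carrier_mat d p" and w: "w \<in> carrier_vec p" "w' \<in> carrier_vec p"
    and ij: "i < d" "j < d" and \<sigma>: "\<sigma> > 0"
  shows "choice_prob F \<sigma> (i, j) w = choice_prob F \<sigma> (i, j) w'
    \<longleftrightarrow> (F *\<^sub>v (w - w')) $ i = (F *\<^sub>v (w - w')) $ j"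
  using F w ij
  by (auto simp: choice_prob_eq_iff[OF \<sigma>] scalar_prod_query_vector[OF F]
      mult_minus_distrib_mat_vec[OF F w])

section \<open>Connected components and their indicator vectors\<close>

lemma equiv_reachable: "equiv {..<d} (reachable d E)"
proof -
  have "sym ((E \<union> E\<inverse>)\<^sup>*)" by (intro sym_rtrancl) (auto simp: sym_def)
  thus ?thesis
    by (intro equivI) (auto simp: reachable_def refl_on_def sym_def trans_def)
qed

text \<open>Equality is symmetric and transitive, so it propagates along a walk whichever way each
  edge is traversed.\<close>

lemma reachable_constant:
  assumes "\<And>i j. (i, j) \<in> E \<Longrightarrow> f i = f j" and "(i, j) \<in> reachable d E"
  shows "f i = f j"
proof -
  have "(i, j) \<in> (E \<union> E\<inverse>)\<^sup>*" using assms(2) by (simp add: reachable_def)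
  thus ?thesis by induction (use assms(1) in force)+
qed

text \<open>The bijection lists each equivalence class exactly once: injectivity makes sets with
  different indices disjoint, surjectivity makes them cover all vertices.\<close>

locale indexed_components =
  fixes d K :: nat and E :: "(nat \<times> nat) set" and C :: "nat \<Rightarrow> nat set"
  assumes E_less: "\<And>i j. (i, j) \<in> E \<Longrightarrow> i < d \<and> j < d"
    and bij: "bij_betw C {..<K} (graph_components d E)"
begin

lemma component_in_quotient: "k < K \<Longrightarrow> C k \<in> {..<d} // reachable d E"
  using bij unfolding bij_betw_def graph_components_def by blast

lemma component_subset: "k < K \<Longrightarrow> C k \<subseteq> {..<d}"
  using Union_quotient[OF equiv_reachable[of d E]] component_in_quotient by blast

lemma component_nonempty: "k < K \<Longrightarrow> C k \<noteq> {}"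
  using in_quotient_imp_non_empty[OF equiv_reachable] component_in_quotient by blast

lemma component_unique:
  assumes "k < K" "k' < K" "i \<in> C k" "i \<in> C k'"
  shows "k = k'"
proof -
  have "C k = C k'"
    using quotient_disj[OF equiv_reachable component_in_quotient component_in_quotient] assms
    by blast
  thus ?thesis using bij assms unfolding bij_betw_def inj_on_def by blast
qed

lemma component_reachable:
  "k < K \<Longrightarrow> i \<in> C k \<Longrightarrow> j \<in> C k \<Longrightarrow> (i, j) \<in> reachable d E"
  using quotient_eq_iff[OF equiv_reachable component_in_quotient component_in_quotient] by blast

lemma in_component_obtain:
  assumes "i < d"
  obtains k where "k < K" "i \<in> C k" "\<And>j. (i, j) \<in> reachable d E \<Longrightarrow> j \<in> C k"
proof -
  let ?X = "reachable d E `` {i}"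
  have "?X \<in> C ` {..<K}"
    using bij assms unfolding bij_betw_def graph_components_def by (auto intro: quotientI)
  moreover have "i \<in> ?X" using assms by (simp add: reachable_def)
  ultimately show ?thesis using that by auto
qed

lemma edge_same_component:
  assumes "(i, j) \<in> E"
  obtains k where "k < K" "i \<in> C k" "j \<in> C k"
proof -
  have "i < d" and r: "(i, j) \<in> reachable d E"
    using E_less[OF assms] assms by (auto simp: reachable_def)
  from in_component_obtain[OF \<open>i < d\<close>] r that show ?thesis by metis
qed

lemma component_matrix_carrier: "component_matrix d K C \<in> carrier_mat d K"
  by (simp add: component_matrix_def)

text \<open>Components are disjoint, so row i has a single 1, in the column of the component
  containing i.\<close>

lemma component_matrix_mult_index:
  assumes c: "c \<in> carrier_vec K" and k: "k < K" and i: "i \<in> C k"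
  shows "(component_matrix d K C *\<^sub>v c) $ i = c $ k"
proof -
  have id: "i < d" using component_subset[OF k] i by auto
  have "(component_matrix d K C *\<^sub>v c) $ i = (\<Sum>k'\<in>{0..<K}. (if i \<in> C k' then 1 else 0) * c $ k')"
    using c id by (simp add: component_matrix_def scalar_prod_def)
  also have "\<dots> = (\<Sum>k'\<in>{0..<K}. if k' = k then c $ k else 0)"
  proof (rule sum.cong[OF refl])
    fix k' assume "k' \<in> {0..<K}"
    hence "i \<in> C k' \<longleftrightarrow> k' = k" using component_unique[OF k, of k' i] i by auto
    thus "(if i \<in> C k' then 1 else 0) * c $ k' = (if k' = k then c $ k else 0)" by simp
  qed
  also have "\<dots> = c $ k" using k by simp
  finally show ?thesis .
qed

text \<open>Each component is nonempty, and the entry at any of its vertices reads off the matching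
  coefficient.\<close>

lemma component_matrix_mult_eq_0D:
  assumes c: "c \<in> carrier_vec K" and "component_matrix d K C *\<^sub>v c = 0\<^sub>v d"
  shows "c = 0\<^sub>v K"
proof (rule eq_vecI)
  fix k assume "k < dim_vec (0\<^sub>v K)"
  hence k: "k < K" by simp
  then obtain i where i: "i \<in> C k" using component_nonempty by blast
  moreover have "i < d" using component_subset[OF k] i by auto
  ultimately show "c $ k = 0\<^sub>v K $ k"
    using component_matrix_mult_index[OF c k i] assms(2) k by simp
qed (use c in auto)

text \<open>Constancy along edges is constancy on components, that is, membership in the span of the
  indicators. The sum form on the right is chosen to match a kernel equation of the block
  matrix.\<close>

lemma constant_on_edges_iff:
  assumes v: "v \<in> carrier_vec d"
  shows "(\<forall>(i, j)\<in>E. v $ i = v $ j)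
    \<longleftrightarrow> (\<exists>c\<in>carrier_vec K. component_matrix d K C *\<^sub>v c + v = 0\<^sub>v d)" (is "?L \<longleftrightarrow> ?R")
proof
  assume L: ?L
  \<comment> \<open>The sign makes the sum cancel. The choice of representative is harmless because
    \<open>v\<close> is constant on each component.\<close>
  define c where "c = vec K (\<lambda>k. - v $ (SOME i. i \<in> C k))"
  have c: "c \<in> carrier_vec K" by (simp add: c_def)
  have "component_matrix d K C *\<^sub>v c + v = 0\<^sub>v d"
  proof (rule eq_vecI)
    fix i assume "i < dim_vec (0\<^sub>v d)"
    hence i: "i < d" by simp
    then obtain k where k: "k < K" "i \<in> C k" using in_component_obtain by blast
    have "(SOME i. i \<in> C k) \<in> C k" using k(2) by (rule someI)
    hence "v $ (SOME i. i \<in> C k) = v $ i"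
      using reachable_constant[where f = "($) v" and E = E] L component_reachable k by blast
    hence "c $ k = - v $ i" using k by (simp add: c_def)
    thus "(component_matrix d K C *\<^sub>v c + v) $ i = 0\<^sub>v d $ i"
      using i v component_matrix_mult_index[OF c k] by simp
  qed (use v in auto)
  thus ?R using c by blast
next
  assume ?R
  then obtain c where c: "c \<in> carrier_vec K" and 0: "component_matrix d K C *\<^sub>v c + v = 0\<^sub>v d"
    by blast
  have val: "v $ i = - c $ k" if "k < K" "i \<in> C k" for i k
  proof -
    have "i < d" using component_subset that by auto
    moreover from this have "(component_matrix d K C *\<^sub>v c + v) $ i = 0" by (simp add: 0)
    ultimately show ?thesis using v component_matrix_mult_index[OF c that] by simp
  qed
  show ?L
  proof clarify
    fix i j assume "(i, j) \<in> E"
    then obtain k where "k < K" "i \<in> C k" "j \<in> C k" using edge_same_component by blast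
    thus "v $ i = v $ j" using val by metis
  qed
qed

text \<open>Full rank means a trivial kernel. Splitting a kernel vector into blocks \<open>c\<close>
  and \<open>t\<close> and eliminating \<open>c\<close> leaves a condition on \<open>t\<close>
  alone.\<close>

lemma rank_append_component_matrix_iff:
  assumes B: "B \<in> carrier_mat d m"
  shows "vec_space.rank d (append_columns (component_matrix d K C) B) = K + m
    \<longleftrightarrow> (\<forall>t\<in>carrier_vec m. (\<forall>(i, j)\<in>E. (B *\<^sub>v t) $ i = (B *\<^sub>v t) $ j) \<longrightarrow> t = 0\<^sub>v m)"
    (is "?rank \<longleftrightarrow> ?R")
proof -
  let ?M = "component_matrix d K C"
  have "?rank \<longleftrightarrow> (\<forall>z\<in>carrier_vec (K + m). append_columns ?M B *\<^sub>v z = 0\<^sub>v d \<longrightarrow> z = 0\<^sub>v (K + m))"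
    by (rule vec_space.rank_eq_dim_col_iff
        [OF append_columns_carrier[OF component_matrix_carrier B]])
  also have "\<dots> \<longleftrightarrow> (\<forall>c\<in>carrier_vec K. \<forall>t\<in>carrier_vec m.
      ?M *\<^sub>v c + B *\<^sub>v t = 0\<^sub>v d \<longrightarrow> c = 0\<^sub>v K \<and> t = 0\<^sub>v m)" (is "?Z \<longleftrightarrow> ?P")
  proof -
    have split: "\<exists>c\<in>carrier_vec K. \<exists>t\<in>carrier_vec m. z = c @\<^sub>v t"
      if "z \<in> carrier_vec (K + m)" for z :: "real vec"
      using vec_first_last_append[OF that] vec_first_carrier vec_last_carrier by metis
    have zero: "c @\<^sub>v t = 0\<^sub>v (K + m) \<longleftrightarrow> c = 0\<^sub>v K \<and> t = 0\<^sub>v m"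
      if "c \<in> carrier_vec K" "t \<in> carrier_vec m" for c t :: "real vec"
    proof -
      have "(0\<^sub>v (K + m) :: real vec) = 0\<^sub>v K @\<^sub>v 0\<^sub>v m" by (intro eq_vecI) auto
      thus ?thesis using that append_vec_eq[of c K "0\<^sub>v K"] by simp
    qed
    note mult = append_columns_mult_append_vec[OF component_matrix_carrier B]
    show ?thesis
    proof
      assume Z: ?Z
      show ?P
      proof (intro ballI impI)
        fix c t :: "real vec"
        assume c: "c \<in> carrier_vec K" and t: "t \<in> carrier_vec m"
          and "?M *\<^sub>v c + B *\<^sub>v t = 0\<^sub>v d"
        hence "c @\<^sub>v t = 0\<^sub>v (K + m)"
          using Z mult[OF c t] append_carrier_vec[OF c t] by simp
        thus "c = 0\<^sub>v K \<and> t = 0\<^sub>v m" using zero[OF c t] by simp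
      qed
    next
      assume P: ?P
      show ?Z
      proof (intro ballI impI)
        fix z :: "real vec"
        assume z: "z \<in> carrier_vec (K + m)" and 0: "append_columns ?M B *\<^sub>v z = 0\<^sub>v d"
        obtain c t where ct: "c \<in> carrier_vec K" "t \<in> carrier_vec m" "z = c @\<^sub>v t"
          using split[OF z] by blast
        hence "c = 0\<^sub>v K \<and> t = 0\<^sub>v m" using P 0 mult[OF ct(1,2)] by simp
        thus "z = 0\<^sub>v (K + m)" using zero[OF ct(1,2)] ct(3) by simp
      qed
    qed
  qed
  \<comment> \<open>The conclusion on \<open>c\<close> may be dropped: once \<open>t\<close>
    vanishes, independence of the indicators forces \<open>c\<close> to vanish too.\<close>
  also have "\<dots> \<longleftrightarrow> (\<forall>t\<in>carrier_vec m. (\<exists>c\<in>carrier_vec K. ?M *\<^sub>v c + B *\<^sub>v t = 0\<^sub>v d) \<longrightarrow> t = 0\<^sub>v m)"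
  proof -
    have "B *\<^sub>v 0\<^sub>v m = 0\<^sub>v d" using B by (intro eq_vecI) auto
    hence "c = 0\<^sub>v K" if "c \<in> carrier_vec K" "?M *\<^sub>v c + B *\<^sub>v 0\<^sub>v m = 0\<^sub>v d" for c
      using that component_matrix_mult_eq_0D[of c] mult_mat_vec_carrier[OF component_matrix_carrier]
      by (metis right_zero_vec)
    thus ?thesis by blast
  qed
  \<comment> \<open>A suitable \<open>c\<close> exists exactly when \<open>B *\<^sub>v t\<close> is
    constant along edges.\<close>
  also have "\<dots> \<longleftrightarrow> ?R"
    using constant_on_edges_iff mult_mat_vec_carrier[OF B] by auto
  finally show ?thesis .
qed

end

section \<open>Feasible differences and the final equivalence\<close>

lemma solution_differences:
  assumes A: "(A :: 'a :: comm_ring_1 mat) \<in> carrier_mat l p" and ex: "\<exists>w\<in>carrier_vec p. A *\<^sub>v w = b"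
  shows "{w - w' |w w'. w \<in> carrier_vec p \<and> w' \<in> carrier_vec p \<and> A *\<^sub>v w = b \<and> A *\<^sub>v w' = b}
    = mat_kernel A"
proof (intro equalityI subsetI)
  fix u assume "u \<in> mat_kernel A"
  note u = mat_kernelD[OF A this]
  \<comment> \<open>Consistency supplies a base point: \<open>w + u\<close> and \<open>w\<close> are
    both feasible and differ by \<open>u\<close>. Without it the set of differences would be empty,
    while the kernel contains zero.\<close>
  obtain w where w: "w \<in> carrier_vec p" "A *\<^sub>v w = b" using ex by blast
  hence "b \<in> carrier_vec l" using A by auto
  hence "A *\<^sub>v (w + u) = b" using mult_add_distrib_mat_vec[OF A w(1) u(1)] u w by simp
  moreover have "u = w + u - w" using u w by auto
  ultimately show "u \<in> {w - w' |w w'. w \<in> carrier_vec p \<and> w' \<in> carrier_vec p \<and> A *\<^sub>v w = b \<and> A *\<^sub>v w' = b}"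
    using u w add_carrier_vec by blast
next
  fix u assume "u \<in> {w - w' |w w'. w \<in> carrier_vec p \<and> w' \<in> carrier_vec p \<and> A *\<^sub>v w = b \<and> A *\<^sub>v w' = b}"
  then obtain w w' where *: "u = w - w'" "w \<in> carrier_vec p" "w' \<in> carrier_vec p"
    "A *\<^sub>v w = b" "A *\<^sub>v w' = b" by blast
  hence "A *\<^sub>v u = b - b" by (simp add: mult_minus_distrib_mat_vec[OF A])
  moreover have "b \<in> carrier_vec l" using * A by auto
  ultimately show "u \<in> mat_kernel A" using * A by (intro mat_kernelI[OF A]) auto
qed

theorem proposition2p3:
  fixes d p l K d\<^sub>\<theta> :: nat
    and x :: "nat \<Rightarrow> 'x" and \<phi> :: "'x \<Rightarrow> real vec"
    and F A V :: "real mat" and b :: "real vec"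
    and \<sigma> :: real
    and E :: "(nat \<times> nat) set"
    and C :: "nat \<Rightarrow> nat set"
  assumes features: "\<And>i. i < d \<Longrightarrow> \<phi> (x i) \<in> carrier_vec p"
    and F_eq: "F = feature_matrix d p \<phi> x"
    and sigma_pos: "0 < \<sigma>"
    and A_carrier: "A \<in> carrier_mat l p"
    and b_carrier: "b \<in> carrier_vec l"
    and consistent: "\<exists>w \<in> carrier_vec p. A *\<^sub>v w = b"
    and d_theta: "d\<^sub>\<theta> = p - vec_space.rank l A"
    and V_carrier: "V \<in> carrier_mat p d\<^sub>\<theta>"
    and V_orthonormal: "orthonormal_columns V"
    and V_spans: "vec_space.col_space p V = mat_kernel A"
    and E_pairs: "E \<subseteq> {(i, j). i < j \<and> j < d}"
    and components: "bij_betw C {..<K} (graph_components d E)"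
  shows "(\<forall>w \<in> {w \<in> carrier_vec p. A *\<^sub>v w = b}. \<forall>w' \<in> {w \<in> carrier_vec p. A *\<^sub>v w = b}.
            (\<forall>\<alpha>\<in>E. choice_prob F \<sigma> \<alpha> w = choice_prob F \<sigma> \<alpha> w') \<longrightarrow> w = w')
         \<longleftrightarrow> vec_space.rank d (append_columns (component_matrix d K C) (F * V)) = d\<^sub>\<theta> + K"
proof -
  have F: "F \<in> carrier_mat d p"
    by (auto simp: F_eq feature_matrix_def)
  have FV: "F * V \<in> carrier_mat d d\<^sub>\<theta>" using F V_carrier by simp
  interpret indexed_components d K E C
    using E_pairs components by unfold_locales auto
  let ?W = "{w \<in> carrier_vec p. A *\<^sub>v w = b}"
  let ?const = "\<lambda>v. \<forall>(i, j)\<in>E. v $ i = v $ j"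
  have prob: "(\<forall>\<alpha>\<in>E. choice_prob F \<sigma> \<alpha> w = choice_prob F \<sigma> \<alpha> w') \<longleftrightarrow> ?const (F *\<^sub>v (w - w'))"
    if "w \<in> ?W" "w' \<in> ?W" for w w'
    using choice_prob_eq_iff_diff[OF F _ _ _ _ sigma_pos] that E_less by fastforce
  have eq: "w = w' \<longleftrightarrow> w - w' = 0\<^sub>v p" if "w \<in> ?W" "w' \<in> ?W" for w w'
    using that by (auto simp: vec_eq_iff)
  have "(\<forall>w\<in>?W. \<forall>w'\<in>?W. (\<forall>\<alpha>\<in>E. choice_prob F \<sigma> \<alpha> w = choice_prob F \<sigma> \<alpha> w') \<longrightarrow> w = w')
    \<longleftrightarrow> (\<forall>w\<in>?W. \<forall>w'\<in>?W. ?const (F *\<^sub>v (w - w')) \<longrightarrow> w - w' = 0\<^sub>v p)"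
    using prob eq by (intro ball_cong refl) blast
  also have "\<dots> \<longleftrightarrow> (\<forall>u\<in>mat_kernel A. ?const (F *\<^sub>v u) \<longrightarrow> u = 0\<^sub>v p)"
    unfolding solution_differences[OF A_carrier consistent, symmetric] by blast
  \<comment> \<open>The spanning assumption parametrizes the null space by coordinate vectors
    \<open>t\<close>.\<close>
  also have "mat_kernel A = (\<lambda>t. V *\<^sub>v t) ` carrier_vec d\<^sub>\<theta>"
    unfolding V_spans[symmetric] vec_space.col_space_eq[OF V_carrier] using V_carrier by auto
  also have "(\<forall>u\<in>(\<lambda>t. V *\<^sub>v t) ` carrier_vec d\<^sub>\<theta>. ?const (F *\<^sub>v u) \<longrightarrow> u = 0\<^sub>v p)
    \<longleftrightarrow> (\<forall>t\<in>carrier_vec d\<^sub>\<theta>. ?const ((F * V) *\<^sub>v t) \<longrightarrow> t = 0\<^sub>v d\<^sub>\<theta>)"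
  proof -
    \<comment> \<open>Orthonormality makes this parametrization injective, so triviality of
      \<open>u\<close> becomes triviality of \<open>t\<close>.\<close>
    have "V *\<^sub>v t = 0\<^sub>v p \<longleftrightarrow> t = 0\<^sub>v d\<^sub>\<theta>" if "t \<in> carrier_vec d\<^sub>\<theta>" for t
    proof
      show "V *\<^sub>v t = 0\<^sub>v p \<Longrightarrow> t = 0\<^sub>v d\<^sub>\<theta>"
        by (rule orthonormal_columns_mult_eq_0D[OF V_carrier V_orthonormal that])
      show "t = 0\<^sub>v d\<^sub>\<theta> \<Longrightarrow> V *\<^sub>v t = 0\<^sub>v p" using V_carrier by (intro eq_vecI) auto
    qed
    moreover have "(F * V) *\<^sub>v t = F *\<^sub>v (V *\<^sub>v t)" if "t \<in> carrier_vec d\<^sub>\<theta>" for t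
      by (rule assoc_mult_mat_vec[OF F V_carrier that])
    ultimately show ?thesis by simp
  qed
  also have "\<dots> \<longleftrightarrow> vec_space.rank d (append_columns (component_matrix d K C) (F * V)) = K + d\<^sub>\<theta>"
    by (rule rank_append_component_matrix_iff[OF FV, symmetric])
  finally show ?thesis by (simp only: add.commute)
qed

end
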